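(* Let $T$ be an additive ternary $\Gamma$-ring with universal operator rng $\mathcal O(T,\Gamma)$. The map $$\iota:T\times\Gamma\times T\times\Gamma\to\mathcal O(T,\Gamma),\qquad (a,\alpha,b,\beta)\mapsto[a,\alpha,b,\beta],$$ is an operator realization of $(T,\Gamma)$ in $\mathcal O(T,\Gamma)$. Moreover, for every operator realization $\lambda$ of $(T,\Gamma)$ in an associative rng $B$, there is a unique rng homomorphism $\overline\lambda:\mathcal O(T,\Gamma)\to B$ satisfying $\overline\lambda\circ\iota=\lambda$.
   Context: A rng is an associative ring, not necessarily unital. An additive ternary $\Gamma$-ring consists of abelian groups $(T,+)$, $(\Gamma,+)$ and a map $T\times\Gamma\times T\times\Gamma\times T\to T$, $(x,\alpha,y,\beta,z)\mapsto x\alpha y\beta z$, additive in each of the five variables, with $(x\alpha y\beta z)\gamma u\delta v=x\alpha(y\beta z\gamma u)\delta v=x\alpha y\beta(z\gamma u\delta v)$ for all $x,y,z,u,v\in T$, $\alpha,\beta,\gamma,\delta\in\Gamma$. Let $F(T,\Gamma)=T\otimes_{\mathbb Z}\Gamma\otimes_{\mathbb Z}T\otimes_{\mathbb Z}\Gamma$ with the (unique, well-defined, associative) bilinear multiplication satisfying $(a\otimes\alpha\otimes b\otimes\beta)(c\otimes\gamma\otimes d\otimes\delta)=(a\alpha b\beta c)\otimes\gamma\otimes d\otimes\delta$. Let $J(T,\Gamma)$ be the two-sided ideal of $F(T,\Gamma)$ generated by all elements $(a\alpha b\beta c)\otimes\gamma\otimes d\otimes\delta-a\otimes\alpha\otimes(b\beta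 c\gamma d)\otimes\delta$. The universal operator rng is $\mathcal O(T,\Gamma)=F(T,\Gamma)/J(T,\Gamma)$, and $[a,\alpha,b,\beta]$ denotes the class of $a\otimes\alpha\otimes b\otimes\beta$. An operator realization of $(T,\Gamma)$ in an associative rng $B$ is a map $\lambda:T\times\Gamma\times T\times\Gamma\to B$, additive in each variable, such that for all $a,b,c,d\in T$ and $\alpha,\beta,\gamma,\delta\in\Gamma$: $\lambda(a,\alpha,b,\beta)\lambda(c,\gamma,d,\delta)=\lambda(a\alpha b\beta c,\gamma,d,\delta)$ and $\lambda(a\alpha b\beta c,\gamma,d,\delta)=\lambda(a,\alpha,b\beta c\gamma d,\delta)$. *)

theory Defs
  imports "HOL-Algebra.Free_Abelian_Groups" "HOL-Algebra.QuotRing" "HOL-Library.FuncSet"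
begin

text \<open>
  An associative, not necessarily unital ring. As in the locale \<^locale>\<open>abelian_group\<close>, the
  underlying record has a field (here \<open>one\<close>) that carries no meaning and is never used. The
  library's \<open>ring\<close>, \<open>ideal\<close>, \<open>genideal\<close> and \<open>ring_hom\<close> all presuppose a unit, hence the
  non-unital versions below.
\<close>

locale rng = abelian_group R for R (structure) +
  assumes rng_m_closed: "\<lbrakk>x \<in> carrier R; y \<in> carrier R\<rbrakk> \<Longrightarrow> x \<otimes> y \<in> carrier R"
    and rng_m_assoc: "\<lbrakk>x \<in> carrier R; y \<in> carrier R; z \<in> carrier R\<rbrakk>
      \<Longrightarrow> (x \<otimes> y) \<otimes> z = x \<otimes> (y \<otimes> z)"
    and rng_l_distr: "\<lbrakk>x \<in> carrier R; y \<in> carrier R; z \<in> carrier R\<rbrakk>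
      \<Longrightarrow> (x \<oplus> y) \<otimes> z = x \<otimes> z \<oplus> y \<otimes> z"
    and rng_r_distr: "\<lbrakk>x \<in> carrier R; y \<in> carrier R; z \<in> carrier R\<rbrakk>
      \<Longrightarrow> z \<otimes> (x \<oplus> y) = z \<otimes> x \<oplus> z \<otimes> y"

locale rng_ideal = additive_subgroup I R + rng R for I and R (structure) +
  assumes rng_I_l_closed: "\<lbrakk>a \<in> I; x \<in> carrier R\<rbrakk> \<Longrightarrow> x \<otimes> a \<in> I"
    and rng_I_r_closed: "\<lbrakk>a \<in> I; x \<in> carrier R\<rbrakk> \<Longrightarrow> a \<otimes> x \<in> I"

definition rng_genideal :: "('a, 'm) ring_scheme \<Rightarrow> 'a set \<Rightarrow> 'a set" where
  "rng_genideal R S = \<Inter>{I. rng_ideal I R \<and> S \<subseteq> I}"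

definition rng_hom :: "('a, 'm) ring_scheme \<Rightarrow> ('b, 'n) ring_scheme \<Rightarrow> ('a \<Rightarrow> 'b) set" where
  "rng_hom R S = {h \<in> carrier R \<rightarrow> carrier S. \<forall>x \<in> carrier R. \<forall>y \<in> carrier R.
     h (x \<oplus>\<^bsub>R\<^esub> y) = h x \<oplus>\<^bsub>S\<^esub> h y \<and> h (x \<otimes>\<^bsub>R\<^esub> y) = h x \<otimes>\<^bsub>S\<^esub> h y}"


text \<open>
  The abelian groups \<open>T\<close> and \<open>\<Gamma>\<close> are given as structures of which only \<open>carrier\<close>, \<open>add\<close> and
  \<open>zero\<close> matter; \<open>p x \<alpha> y \<beta> z\<close> is the ternary product \<open>x\<alpha>y\<beta>z\<close>.
\<close>

locale ternary_gamma_ring = T: abelian_group T + G: abelian_group \<Gamma>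
  for T :: "('t, 'm) ring_scheme" and \<Gamma> :: "('g, 'n) ring_scheme" +
  fixes p :: "'t \<Rightarrow> 'g \<Rightarrow> 't \<Rightarrow> 'g \<Rightarrow> 't \<Rightarrow> 't"
  assumes p_closed: "\<lbrakk>x \<in> carrier T; \<alpha> \<in> carrier \<Gamma>; y \<in> carrier T; \<beta> \<in> carrier \<Gamma>; z \<in> carrier T\<rbrakk>
      \<Longrightarrow> p x \<alpha> y \<beta> z \<in> carrier T"
    and p_add1: "\<lbrakk>x \<in> carrier T; x' \<in> carrier T; \<alpha> \<in> carrier \<Gamma>; y \<in> carrier T; \<beta> \<in> carrier \<Gamma>;
      z \<in> carrier T\<rbrakk> \<Longrightarrow> p (x \<oplus>\<^bsub>T\<^esub> x') \<alpha> y \<beta> z = p x \<alpha> y \<beta> z \<oplus>\<^bsub>T\<^esub> p x' \<alpha> y \<beta> z"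
    and p_add2: "\<lbrakk>x \<in> carrier T; \<alpha> \<in> carrier \<Gamma>; \<alpha>' \<in> carrier \<Gamma>; y \<in> carrier T; \<beta> \<in> carrier \<Gamma>;
      z \<in> carrier T\<rbrakk> \<Longrightarrow> p x (\<alpha> \<oplus>\<^bsub>\<Gamma>\<^esub> \<alpha>') y \<beta> z = p x \<alpha> y \<beta> z \<oplus>\<^bsub>T\<^esub> p x \<alpha>' y \<beta> z"
    and p_add3: "\<lbrakk>x \<in> carrier T; \<alpha> \<in> carrier \<Gamma>; y \<in> carrier T; y' \<in> carrier T; \<beta> \<in> carrier \<Gamma>;
      z \<in> carrier T\<rbrakk> \<Longrightarrow> p x \<alpha> (y \<oplus>\<^bsub>T\<^esub> y') \<beta> z = p x \<alpha> y \<beta> z \<oplus>\<^bsub>T\<^esub> p x \<alpha> y' \<beta> z"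
    and p_add4: "\<lbrakk>x \<in> carrier T; \<alpha> \<in> carrier \<Gamma>; y \<in> carrier T; \<beta> \<in> carrier \<Gamma>; \<beta>' \<in> carrier \<Gamma>;
      z \<in> carrier T\<rbrakk> \<Longrightarrow> p x \<alpha> y (\<beta> \<oplus>\<^bsub>\<Gamma>\<^esub> \<beta>') z = p x \<alpha> y \<beta> z \<oplus>\<^bsub>T\<^esub> p x \<alpha> y \<beta>' z"
    and p_add5: "\<lbrakk>x \<in> carrier T; \<alpha> \<in> carrier \<Gamma>; y \<in> carrier T; \<beta> \<in> carrier \<Gamma>; z \<in> carrier T;
      z' \<in> carrier T\<rbrakk> \<Longrightarrow> p x \<alpha> y \<beta> (z \<oplus>\<^bsub>T\<^esub> z') = p x \<alpha> y \<beta> z \<oplus>\<^bsub>T\<^esub> p x \<alpha> y \<beta> z'"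
    and p_assoc_left: "\<lbrakk>x \<in> carrier T; \<alpha> \<in> carrier \<Gamma>; y \<in> carrier T; \<beta> \<in> carrier \<Gamma>; z \<in> carrier T;
      \<gamma> \<in> carrier \<Gamma>; u \<in> carrier T; \<delta> \<in> carrier \<Gamma>; v \<in> carrier T\<rbrakk>
      \<Longrightarrow> p (p x \<alpha> y \<beta> z) \<gamma> u \<delta> v = p x \<alpha> (p y \<beta> z \<gamma> u) \<delta> v"
    and p_assoc_right: "\<lbrakk>x \<in> carrier T; \<alpha> \<in> carrier \<Gamma>; y \<in> carrier T; \<beta> \<in> carrier \<Gamma>; z \<in> carrier T;
      \<gamma> \<in> carrier \<Gamma>; u \<in> carrier T; \<delta> \<in> carrier \<Gamma>; v \<in> carrier T\<rbrakk>
      \<Longrightarrow> p x \<alpha> (p y \<beta> z \<gamma> u) \<delta> v = p x \<alpha> y \<beta> (p z \<gamma> u \<delta> v)"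


definition quads :: "('t, 'm) ring_scheme \<Rightarrow> ('g, 'n) ring_scheme \<Rightarrow> ('t \<times> 'g \<times> 't \<times> 'g) set" where
  "quads T \<Gamma> = carrier T \<times> carrier \<Gamma> \<times> carrier T \<times> carrier \<Gamma>"

fun quad_mult :: "('t \<Rightarrow> 'g \<Rightarrow> 't \<Rightarrow> 'g \<Rightarrow> 't \<Rightarrow> 't) \<Rightarrow>
    't \<times> 'g \<times> 't \<times> 'g \<Rightarrow> 't \<times> 'g \<times> 't \<times> 'g \<Rightarrow> 't \<times> 'g \<times> 't \<times> 'g" where
  "quad_mult p (a, \<alpha>, b, \<beta>) (c, \<gamma>, d, \<delta>) = (p a \<alpha> b \<beta> c, \<gamma>, d, \<delta>)"

text \<open>
  The free abelian group on the quadruples, with the biadditive extension of \<^const>\<open>quad_mult\<close>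
  as multiplication.
\<close>

definition free_quad_rng :: "('t, 'm) ring_scheme \<Rightarrow> ('g, 'n) ring_scheme \<Rightarrow>
    ('t \<Rightarrow> 'g \<Rightarrow> 't \<Rightarrow> 'g \<Rightarrow> 't \<Rightarrow> 't) \<Rightarrow> (('t \<times> 'g \<times> 't \<times> 'g) \<Rightarrow>\<^sub>0 int) ring" where
  "free_quad_rng T \<Gamma> p =
    \<lparr>carrier = carrier (free_Abelian_group (quads T \<Gamma>)),
     mult = (\<lambda>x y. frag_extend (\<lambda>q. frag_extend (\<lambda>r. frag_of (quad_mult p q r)) y) x),
     one = undefined, zero = 0, add = (+)\<rparr>"

definition tensor_relators :: "('t, 'm) ring_scheme \<Rightarrow> ('g, 'n) ring_scheme \<Rightarrow>
    (('t \<times> 'g \<times> 't \<times> 'g) \<Rightarrow>\<^sub>0 int) set" where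
  "tensor_relators T \<Gamma> =
     {frag_of (a \<oplus>\<^bsub>T\<^esub> a', \<alpha>, b, \<beta>) - frag_of (a, \<alpha>, b, \<beta>) - frag_of (a', \<alpha>, b, \<beta>) | a a' \<alpha> b \<beta>.
        a \<in> carrier T \<and> a' \<in> carrier T \<and> \<alpha> \<in> carrier \<Gamma> \<and> b \<in> carrier T \<and> \<beta> \<in> carrier \<Gamma>} \<union>
     {frag_of (a, \<alpha> \<oplus>\<^bsub>\<Gamma>\<^esub> \<alpha>', b, \<beta>) - frag_of (a, \<alpha>, b, \<beta>) - frag_of (a, \<alpha>', b, \<beta>) | a \<alpha> \<alpha>' b \<beta>.
        a \<in> carrier T \<and> \<alpha> \<in> carrier \<Gamma> \<and> \<alpha>' \<in> carrier \<Gamma> \<and> b \<in> carrier T \<and> \<beta> \<in> carrier \<Gamma>} \<union>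
     {frag_of (a, \<alpha>, b \<oplus>\<^bsub>T\<^esub> b', \<beta>) - frag_of (a, \<alpha>, b, \<beta>) - frag_of (a, \<alpha>, b', \<beta>) | a \<alpha> b b' \<beta>.
        a \<in> carrier T \<and> \<alpha> \<in> carrier \<Gamma> \<and> b \<in> carrier T \<and> b' \<in> carrier T \<and> \<beta> \<in> carrier \<Gamma>} \<union>
     {frag_of (a, \<alpha>, b, \<beta> \<oplus>\<^bsub>\<Gamma>\<^esub> \<beta>') - frag_of (a, \<alpha>, b, \<beta>) - frag_of (a, \<alpha>, b, \<beta>') | a \<alpha> b \<beta> \<beta>'.
        a \<in> carrier T \<and> \<alpha> \<in> carrier \<Gamma> \<and> b \<in> carrier T \<and> \<beta> \<in> carrier \<Gamma> \<and> \<beta>' \<in> carrier \<Gamma>}"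

definition tensor_kernel :: "('t, 'm) ring_scheme \<Rightarrow> ('g, 'n) ring_scheme \<Rightarrow>
    (('t \<times> 'g \<times> 't \<times> 'g) \<Rightarrow>\<^sub>0 int) set" where
  "tensor_kernel T \<Gamma> = generate (free_Abelian_group (quads T \<Gamma>)) (tensor_relators T \<Gamma>)"

text \<open>
  The rng \<open>F(T,\<Gamma>)\<close>. Its additive group is the fourfold tensor product \<open>T \<otimes> \<Gamma> \<otimes> T \<otimes> \<Gamma>\<close> over
  the integers, as the free abelian group on quadruples modulo the subgroup \<^const>\<open>tensor_kernel\<close>.
  The multiplication, induced on cosets by that of \<^const>\<open>free_quad_rng\<close>, is the biadditive one
  with \<open>(a \<otimes> \<alpha> \<otimes> b \<otimes> \<beta>)(c \<otimes> \<gamma> \<otimes> d \<otimes> \<delta>) = a\<alpha>b\<beta>c \<otimes> \<gamma> \<otimes> d \<otimes> \<delta>\<close>; this is proved at the end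
  of the theory.
\<close>

definition tensor_rng :: "('t, 'm) ring_scheme \<Rightarrow> ('g, 'n) ring_scheme \<Rightarrow>
    ('t \<Rightarrow> 'g \<Rightarrow> 't \<Rightarrow> 'g \<Rightarrow> 't \<Rightarrow> 't) \<Rightarrow> (('t \<times> 'g \<times> 't \<times> 'g) \<Rightarrow>\<^sub>0 int) set ring" where
  "tensor_rng T \<Gamma> p = free_quad_rng T \<Gamma> p Quot tensor_kernel T \<Gamma>"

definition pure_tensor :: "('t, 'm) ring_scheme \<Rightarrow> ('g, 'n) ring_scheme \<Rightarrow>
    ('t \<Rightarrow> 'g \<Rightarrow> 't \<Rightarrow> 'g \<Rightarrow> 't \<Rightarrow> 't) \<Rightarrow>
    't \<times> 'g \<times> 't \<times> 'g \<Rightarrow> (('t \<times> 'g \<times> 't \<times> 'g) \<Rightarrow>\<^sub>0 int) set" where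
  "pure_tensor T \<Gamma> p q = tensor_kernel T \<Gamma> +>\<^bsub>free_quad_rng T \<Gamma> p\<^esub> frag_of q"

definition operator_ideal :: "('t, 'm) ring_scheme \<Rightarrow> ('g, 'n) ring_scheme \<Rightarrow>
    ('t \<Rightarrow> 'g \<Rightarrow> 't \<Rightarrow> 'g \<Rightarrow> 't \<Rightarrow> 't) \<Rightarrow> (('t \<times> 'g \<times> 't \<times> 'g) \<Rightarrow>\<^sub>0 int) set set" where
  "operator_ideal T \<Gamma> p = rng_genideal (tensor_rng T \<Gamma> p)
     {pure_tensor T \<Gamma> p (p a \<alpha> b \<beta> c, \<gamma>, d, \<delta>)
        \<ominus>\<^bsub>tensor_rng T \<Gamma> p\<^esub> pure_tensor T \<Gamma> p (a, \<alpha>, p b \<beta> c \<gamma> d, \<delta>) | a \<alpha> b \<beta> c \<gamma> d \<delta>.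
        a \<in> carrier T \<and> \<alpha> \<in> carrier \<Gamma> \<and> b \<in> carrier T \<and> \<beta> \<in> carrier \<Gamma> \<and>
        c \<in> carrier T \<and> \<gamma> \<in> carrier \<Gamma> \<and> d \<in> carrier T \<and> \<delta> \<in> carrier \<Gamma>}"

definition universal_operator_rng :: "('t, 'm) ring_scheme \<Rightarrow> ('g, 'n) ring_scheme \<Rightarrow>
    ('t \<Rightarrow> 'g \<Rightarrow> 't \<Rightarrow> 'g \<Rightarrow> 't \<Rightarrow> 't) \<Rightarrow> (('t \<times> 'g \<times> 't \<times> 'g) \<Rightarrow>\<^sub>0 int) set set ring" where
  "universal_operator_rng T \<Gamma> p = tensor_rng T \<Gamma> p Quot operator_ideal T \<Gamma> p"

definition operator_class :: "('t, 'm) ring_scheme \<Rightarrow> ('g, 'n) ring_scheme \<Rightarrow>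
    ('t \<Rightarrow> 'g \<Rightarrow> 't \<Rightarrow> 'g \<Rightarrow> 't \<Rightarrow> 't) \<Rightarrow>
    't \<times> 'g \<times> 't \<times> 'g \<Rightarrow> (('t \<times> 'g \<times> 't \<times> 'g) \<Rightarrow>\<^sub>0 int) set set" where
  "operator_class T \<Gamma> p q = operator_ideal T \<Gamma> p +>\<^bsub>tensor_rng T \<Gamma> p\<^esub> pure_tensor T \<Gamma> p q"


locale operator_realization = ternary_gamma_ring T \<Gamma> p + B: rng B
  for T :: "('t, 'm) ring_scheme" and \<Gamma> :: "('g, 'n) ring_scheme"
    and p :: "'t \<Rightarrow> 'g \<Rightarrow> 't \<Rightarrow> 'g \<Rightarrow> 't \<Rightarrow> 't" and B :: "('b, 'k) ring_scheme" +
  fixes l :: "'t \<times> 'g \<times> 't \<times> 'g \<Rightarrow> 'b"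
  assumes l_closed: "l \<in> quads T \<Gamma> \<rightarrow> carrier B"
    and l_add1: "\<lbrakk>a \<in> carrier T; a' \<in> carrier T; \<alpha> \<in> carrier \<Gamma>; b \<in> carrier T; \<beta> \<in> carrier \<Gamma>\<rbrakk>
      \<Longrightarrow> l (a \<oplus>\<^bsub>T\<^esub> a', \<alpha>, b, \<beta>) = l (a, \<alpha>, b, \<beta>) \<oplus>\<^bsub>B\<^esub> l (a', \<alpha>, b, \<beta>)"
    and l_add2: "\<lbrakk>a \<in> carrier T; \<alpha> \<in> carrier \<Gamma>; \<alpha>' \<in> carrier \<Gamma>; b \<in> carrier T; \<beta> \<in> carrier \<Gamma>\<rbrakk>
      \<Longrightarrow> l (a, \<alpha> \<oplus>\<^bsub>\<Gamma>\<^esub> \<alpha>', b, \<beta>) = l (a, \<alpha>, b, \<beta>) \<oplus>\<^bsub>B\<^esub> l (a, \<alpha>', b, \<beta>)"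
    and l_add3: "\<lbrakk>a \<in> carrier T; \<alpha> \<in> carrier \<Gamma>; b \<in> carrier T; b' \<in> carrier T; \<beta> \<in> carrier \<Gamma>\<rbrakk>
      \<Longrightarrow> l (a, \<alpha>, b \<oplus>\<^bsub>T\<^esub> b', \<beta>) = l (a, \<alpha>, b, \<beta>) \<oplus>\<^bsub>B\<^esub> l (a, \<alpha>, b', \<beta>)"
    and l_add4: "\<lbrakk>a \<in> carrier T; \<alpha> \<in> carrier \<Gamma>; b \<in> carrier T; \<beta> \<in> carrier \<Gamma>; \<beta>' \<in> carrier \<Gamma>\<rbrakk>
      \<Longrightarrow> l (a, \<alpha>, b, \<beta> \<oplus>\<^bsub>\<Gamma>\<^esub> \<beta>') = l (a, \<alpha>, b, \<beta>) \<oplus>\<^bsub>B\<^esub> l (a, \<alpha>, b, \<beta>')"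
    and l_mult: "\<lbrakk>a \<in> carrier T; \<alpha> \<in> carrier \<Gamma>; b \<in> carrier T; \<beta> \<in> carrier \<Gamma>;
        c \<in> carrier T; \<gamma> \<in> carrier \<Gamma>; d \<in> carrier T; \<delta> \<in> carrier \<Gamma>\<rbrakk>
      \<Longrightarrow> l (a, \<alpha>, b, \<beta>) \<otimes>\<^bsub>B\<^esub> l (c, \<gamma>, d, \<delta>) = l (p a \<alpha> b \<beta> c, \<gamma>, d, \<delta>)"
    and l_shift: "\<lbrakk>a \<in> carrier T; \<alpha> \<in> carrier \<Gamma>; b \<in> carrier T; \<beta> \<in> carrier \<Gamma>;
        c \<in> carrier T; \<gamma> \<in> carrier \<Gamma>; d \<in> carrier T; \<delta> \<in> carrier \<Gamma>\<rbrakk>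
      \<Longrightarrow> l (p a \<alpha> b \<beta> c, \<gamma>, d, \<delta>) = l (a, \<alpha>, p b \<beta> c \<gamma> d, \<delta>)"


text \<open>
  That \<^const>\<open>tensor_rng\<close> is the intended rng: it is a rng, its pure tensors are additive in each
  variable and multiply by \<^const>\<open>quad_mult\<close> (\<open>rng_tensor_rng\<close>, \<open>pure_tensor_additive\<close>,
  \<open>pure_tensor_mult\<close>).
\<close>

sublocale rng_ideal \<subseteq> abelian_subgroup I R
  by (intro abelian_subgroupI3 additive_subgroup_axioms abelian_group_axioms)

lemma (in rng_ideal) rng_rcoset_mult_add:
  assumes "x \<in> carrier R" "y \<in> carrier R"
  shows "rcoset_mult R I (I +> x) (I +> y) = I +> (x \<otimes> y)"
proof -
  have "I +> (x' \<otimes> y') = I +> (x \<otimes> y)" if x': "x' \<in> I +> x" and y': "y' \<in> I +> y" for x' y'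
  proof -
    obtain hx hy where h: "hx \<in> I" "hy \<in> I" "x' = hx \<oplus> x" "y' = hy \<oplus> y"
      using x' y' by (auto simp: a_r_coset_def r_coset_def)
    note carr = assms h(1,2)[THEN a_Hcarr]
    have "x' \<otimes> y' = (hx \<otimes> (hy \<oplus> y) \<oplus> x \<otimes> hy) \<oplus> x \<otimes> y"
      unfolding h using carr by (simp add: rng_l_distr rng_r_distr rng_m_closed a_ac)
    moreover have "hx \<otimes> (hy \<oplus> y) \<oplus> x \<otimes> hy \<in> I"
      using h carr by (simp add: rng_I_l_closed rng_I_r_closed)
    ultimately have "x' \<otimes> y' \<in> I +> (x \<otimes> y)"
      by (auto simp: a_r_coset_def r_coset_def)
    then show ?thesis
      using a_repr_independence' rng_m_closed assms by metis
  qed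
  moreover have "x \<in> I +> x" "y \<in> I +> y" using assms a_rcos_self by auto
  ultimately show ?thesis unfolding rcoset_mult_def by blast
qed

lemma (in rng_ideal) rng_quotient: "rng (R Quot I)"
proof (intro rng.intro rng_axioms.intro)
  show "abelian_group (R Quot I)"
    by (rule comm_group_abelian_groupI)
      (simp add: FactRing_def a_factorgroup_is_comm_group[unfolded A_FactGroup_def'])
qed (auto simp: FactRing_simps rng_rcoset_mult_add a_rcos_sum rng_m_closed rng_m_assoc
      rng_l_distr rng_r_distr)

context ternary_gamma_ring
begin

lemma quad_mult_closed:
  "q \<in> quads T \<Gamma> \<Longrightarrow> r \<in> quads T \<Gamma> \<Longrightarrow> quad_mult p q r \<in> quads T \<Gamma>"
  by (auto simp: quads_def p_closed)

lemma quad_mult_assoc: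
  "q \<in> quads T \<Gamma> \<Longrightarrow> r \<in> quads T \<Gamma> \<Longrightarrow> s \<in> quads T \<Gamma> \<Longrightarrow>
    quad_mult p (quad_mult p q r) s = quad_mult p q (quad_mult p r s)"
  by (auto simp: quads_def p_assoc_left p_assoc_right)

abbreviation (input) "FR \<equiv> free_quad_rng T \<Gamma> p"

lemma FR_simps [simp]:
  "x \<in> carrier FR \<longleftrightarrow> Poly_Mapping.keys x \<subseteq> quads T \<Gamma>"
  "x \<oplus>\<^bsub>FR\<^esub> y = x + y" "\<zero>\<^bsub>FR\<^esub> = 0"
  by (auto simp: free_quad_rng_def)

lemma FR_add_monoid: "add_monoid FR = free_Abelian_group (quads T \<Gamma>)"
  by (simp add: free_quad_rng_def free_Abelian_group_def)

lemma FR_abelian_group: "abelian_group FR"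
  by (rule comm_group_abelian_groupI) (simp only: FR_add_monoid abelian_free_Abelian_group)

lemma frag_extend_fun_diff: "frag_extend (\<lambda>q. f q - g q) x = frag_extend f x - frag_extend g x"
  by (induction x rule: frag_induction[OF subset_UNIV]) (auto simp: frag_extend_diff)

lemma frag_extend_fun_add: "frag_extend (\<lambda>q. f q + g q) x = frag_extend f x + frag_extend g x"
  by (induction x rule: frag_induction[OF subset_UNIV]) (auto simp: frag_extend_diff)

lemma FR_mult:
  "frag_of q \<otimes>\<^bsub>FR\<^esub> frag_of r = frag_of (quad_mult p q r)"
  "(x + x') \<otimes>\<^bsub>FR\<^esub> y = x \<otimes>\<^bsub>FR\<^esub> y + x' \<otimes>\<^bsub>FR\<^esub> y"
  "x \<otimes>\<^bsub>FR\<^esub> (y + y') = x \<otimes>\<^bsub>FR\<^esub> y + x \<otimes>\<^bsub>FR\<^esub> y'"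
  "(x - x') \<otimes>\<^bsub>FR\<^esub> y = x \<otimes>\<^bsub>FR\<^esub> y - x' \<otimes>\<^bsub>FR\<^esub> y"
  "x \<otimes>\<^bsub>FR\<^esub> (y - y') = x \<otimes>\<^bsub>FR\<^esub> y - x \<otimes>\<^bsub>FR\<^esub> y'"
  "0 \<otimes>\<^bsub>FR\<^esub> y = 0" "x \<otimes>\<^bsub>FR\<^esub> 0 = 0"
  by (simp_all add: free_quad_rng_def frag_extend_add frag_extend_diff frag_extend_fun_add
      frag_extend_fun_diff frag_extend_eq_0)

lemma rng_FR: "rng FR"
proof (intro rng.intro rng_axioms.intro FR_abelian_group)
  fix x y assume "x \<in> carrier FR" "y \<in> carrier FR"
  then have x: "Poly_Mapping.keys x \<subseteq> quads T \<Gamma>" and y: "Poly_Mapping.keys y \<subseteq> quads T \<Gamma>" by auto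
  have one: "Poly_Mapping.keys (frag_of q \<otimes>\<^bsub>FR\<^esub> y) \<subseteq> quads T \<Gamma>" if q: "q \<in> quads T \<Gamma>" for q
    using y by (induction y rule: frag_induction)
      (use q in \<open>auto simp: FR_mult quad_mult_closed dest!: subsetD[OF keys_diff]\<close>)
  show "x \<otimes>\<^bsub>FR\<^esub> y \<in> carrier FR" unfolding FR_simps
    using x by (induction x rule: frag_induction)
      (use one in \<open>auto simp: FR_mult dest!: subsetD[OF keys_diff]\<close>)
next
  fix x y z assume "x \<in> carrier FR" "y \<in> carrier FR" "z \<in> carrier FR"
  then have x: "Poly_Mapping.keys x \<subseteq> quads T \<Gamma>" and y: "Poly_Mapping.keys y \<subseteq> quads T \<Gamma>"
    and z: "Poly_Mapping.keys z \<subseteq> quads T \<Gamma>" by auto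
  have 1: "frag_of q \<otimes>\<^bsub>FR\<^esub> frag_of r \<otimes>\<^bsub>FR\<^esub> z = frag_of q \<otimes>\<^bsub>FR\<^esub> (frag_of r \<otimes>\<^bsub>FR\<^esub> z)"
    if "q \<in> quads T \<Gamma>" "r \<in> quads T \<Gamma>" for q r
    using z by (induction z rule: frag_induction) (auto simp: that FR_mult quad_mult_assoc)
  have 2: "frag_of q \<otimes>\<^bsub>FR\<^esub> y \<otimes>\<^bsub>FR\<^esub> z = frag_of q \<otimes>\<^bsub>FR\<^esub> (y \<otimes>\<^bsub>FR\<^esub> z)" if "q \<in> quads T \<Gamma>" for q
    using y by (induction y rule: frag_induction) (auto simp: that FR_mult(2-) 1)
  show "x \<otimes>\<^bsub>FR\<^esub> y \<otimes>\<^bsub>FR\<^esub> z = x \<otimes>\<^bsub>FR\<^esub> (y \<otimes>\<^bsub>FR\<^esub> z)"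
    using x by (induction x rule: frag_induction) (auto simp: FR_mult(2-) 2)
qed (auto simp: FR_mult)

lemma relators_subset: "tensor_relators T \<Gamma> \<subseteq> carrier (free_Abelian_group (quads T \<Gamma>))"
proof -
  have "frag_of q - frag_of r - frag_of s \<in> carrier (free_Abelian_group (quads T \<Gamma>))"
    if "q \<in> quads T \<Gamma>" "r \<in> quads T \<Gamma>" "s \<in> quads T \<Gamma>" for q r s
    using that by (auto dest!: subsetD[OF keys_diff])
  then show ?thesis by (auto simp: tensor_relators_def quads_def simp del: carrier_free_Abelian_group_iff)
qed

lemma kernel_subgroup: "subgroup (tensor_kernel T \<Gamma>) (free_Abelian_group (quads T \<Gamma>))"
  unfolding tensor_kernel_def
  by (rule group.generate_is_subgroup[OF group_free_Abelian_group relators_subset])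

lemma kernel_0: "0 \<in> tensor_kernel T \<Gamma>"
  using subgroup.one_closed[OF kernel_subgroup] by simp

lemma kernel_diff:
  assumes "x \<in> tensor_kernel T \<Gamma>" "y \<in> tensor_kernel T \<Gamma>"
  shows "x - y \<in> tensor_kernel T \<Gamma>"
proof -
  have "Poly_Mapping.keys y \<subseteq> quads T \<Gamma>"
    using subgroup.mem_carrier[OF kernel_subgroup assms(2)] by simp
  then have "- y \<in> tensor_kernel T \<Gamma>"
    using subgroup.m_inv_closed[OF kernel_subgroup assms(2)] by simp
  then show ?thesis
    using subgroup.m_closed[OF kernel_subgroup assms(1)] by fastforce
qed

lemma kernel_rel: "x \<in> tensor_relators T \<Gamma> \<Longrightarrow> x \<in> tensor_kernel T \<Gamma>"
  by (simp add: tensor_kernel_def generate.incl)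

lemma kernel_induct [consumes 1, case_names rel zero diff]:
  assumes "x \<in> tensor_kernel T \<Gamma>"
    and "\<And>x. x \<in> tensor_relators T \<Gamma> \<Longrightarrow> P x" "P 0" and diff: "\<And>x y. P x \<Longrightarrow> P y \<Longrightarrow> P (x - y)"
  shows "P x"
  using assms(1) unfolding tensor_kernel_def
proof (induction rule: generate.induct)
  case (inv h)
  then show ?case using relators_subset diff[OF assms(3) assms(2)] by (auto simp: subset_iff)
next
  case (eng h1 h2)
  then show ?case using diff[OF eng(3) diff[OF assms(3) eng(4)]] by simp
qed (use assms in auto)

lemma relatorI:
  assumes "a \<in> carrier T" "\<alpha> \<in> carrier \<Gamma>" "b \<in> carrier T" "\<beta> \<in> carrier \<Gamma>"
  shows "a' \<in> carrier T \<Longrightarrow> frag_of (a \<oplus>\<^bsub>T\<^esub> a', \<alpha>, b, \<beta>) - frag_of (a, \<alpha>, b, \<beta>) - frag_of (a', \<alpha>, b, \<beta>)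
      \<in> tensor_relators T \<Gamma>"
    and "\<alpha>' \<in> carrier \<Gamma> \<Longrightarrow> frag_of (a, \<alpha> \<oplus>\<^bsub>\<Gamma>\<^esub> \<alpha>', b, \<beta>) - frag_of (a, \<alpha>, b, \<beta>) - frag_of (a, \<alpha>', b, \<beta>)
      \<in> tensor_relators T \<Gamma>"
    and "b' \<in> carrier T \<Longrightarrow> frag_of (a, \<alpha>, b \<oplus>\<^bsub>T\<^esub> b', \<beta>) - frag_of (a, \<alpha>, b, \<beta>) - frag_of (a, \<alpha>, b', \<beta>)
      \<in> tensor_relators T \<Gamma>"
    and "\<beta>' \<in> carrier \<Gamma> \<Longrightarrow> frag_of (a, \<alpha>, b, \<beta> \<oplus>\<^bsub>\<Gamma>\<^esub> \<beta>') - frag_of (a, \<alpha>, b, \<beta>) - frag_of (a, \<alpha>, b, \<beta>')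
      \<in> tensor_relators T \<Gamma>"
  unfolding tensor_relators_def using assms by blast+

lemma relatorE:
  assumes "x \<in> tensor_relators T \<Gamma>"
    and "\<And>a \<alpha> b \<beta> a'. \<lbrakk>a \<in> carrier T; \<alpha> \<in> carrier \<Gamma>; b \<in> carrier T; \<beta> \<in> carrier \<Gamma>; a' \<in> carrier T\<rbrakk>
      \<Longrightarrow> P (frag_of (a \<oplus>\<^bsub>T\<^esub> a', \<alpha>, b, \<beta>) - frag_of (a, \<alpha>, b, \<beta>) - frag_of (a', \<alpha>, b, \<beta>))"
    and "\<And>a \<alpha> b \<beta> \<alpha>'. \<lbrakk>a \<in> carrier T; \<alpha> \<in> carrier \<Gamma>; b \<in> carrier T; \<beta> \<in> carrier \<Gamma>; \<alpha>' \<in> carrier \<Gamma>\<rbrakk>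
      \<Longrightarrow> P (frag_of (a, \<alpha> \<oplus>\<^bsub>\<Gamma>\<^esub> \<alpha>', b, \<beta>) - frag_of (a, \<alpha>, b, \<beta>) - frag_of (a, \<alpha>', b, \<beta>))"
    and "\<And>a \<alpha> b \<beta> b'. \<lbrakk>a \<in> carrier T; \<alpha> \<in> carrier \<Gamma>; b \<in> carrier T; \<beta> \<in> carrier \<Gamma>; b' \<in> carrier T\<rbrakk>
      \<Longrightarrow> P (frag_of (a, \<alpha>, b \<oplus>\<^bsub>T\<^esub> b', \<beta>) - frag_of (a, \<alpha>, b, \<beta>) - frag_of (a, \<alpha>, b', \<beta>))"
    and "\<And>a \<alpha> b \<beta> \<beta>'. \<lbrakk>a \<in> carrier T; \<alpha> \<in> carrier \<Gamma>; b \<in> carrier T; \<beta> \<in> carrier \<Gamma>; \<beta>' \<in> carrier \<Gamma>\<rbrakk>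
      \<Longrightarrow> P (frag_of (a, \<alpha>, b, \<beta> \<oplus>\<^bsub>\<Gamma>\<^esub> \<beta>') - frag_of (a, \<alpha>, b, \<beta>) - frag_of (a, \<alpha>, b, \<beta>'))"
  shows "P x"
  using assms(1) unfolding tensor_relators_def Un_iff mem_Collect_eq
  by (elim disjE exE conjE) (simp_all add: assms(2-))

lemma relator_mult:
  assumes "x \<in> tensor_relators T \<Gamma>" "r \<in> quads T \<Gamma>"
  shows "x \<otimes>\<^bsub>FR\<^esub> frag_of r \<in> tensor_relators T \<Gamma>" "frag_of r \<otimes>\<^bsub>FR\<^esub> x \<in> tensor_relators T \<Gamma>"
proof -
  obtain c \<gamma> d \<delta> where r: "r = (c, \<gamma>, d, \<delta>)" "c \<in> carrier T" "\<gamma> \<in> carrier \<Gamma>" "d \<in> carrier T" "\<delta> \<in> carrier \<Gamma>"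
    using assms(2) by (auto simp: quads_def)
  show "x \<otimes>\<^bsub>FR\<^esub> frag_of r \<in> tensor_relators T \<Gamma>"
    using assms(1) by (rule relatorE)
      (simp_all add: r FR_mult p_add1 p_add2 p_add3 p_add4 p_closed relatorI)
  show "frag_of r \<otimes>\<^bsub>FR\<^esub> x \<in> tensor_relators T \<Gamma>"
    using assms(1) by (rule relatorE) (simp_all add: r FR_mult p_add5 p_closed relatorI)
qed

lemma kernel_ideal: "rng_ideal (tensor_kernel T \<Gamma>) FR"
proof (intro rng_ideal.intro rng_FR rng_ideal_axioms.intro)
  show "additive_subgroup (tensor_kernel T \<Gamma>) FR"
    by (rule additive_subgroup.intro) (simp only: FR_add_monoid kernel_subgroup)
next
  fix a x assume a: "a \<in> tensor_kernel T \<Gamma>" and "x \<in> carrier FR"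
  then have x: "Poly_Mapping.keys x \<subseteq> quads T \<Gamma>" by simp
  have "frag_of q \<otimes>\<^bsub>FR\<^esub> a \<in> tensor_kernel T \<Gamma>" if "q \<in> quads T \<Gamma>" for q
    using a by (induction rule: kernel_induct)
      (auto simp: FR_mult kernel_diff kernel_0 relator_mult(2) kernel_rel that)
  then show "x \<otimes>\<^bsub>FR\<^esub> a \<in> tensor_kernel T \<Gamma>"
    by (intro frag_induction[OF x, where P = "\<lambda>x. x \<otimes>\<^bsub>FR\<^esub> a \<in> tensor_kernel T \<Gamma>"]) (auto simp: FR_mult kernel_diff kernel_0)
  have "a \<otimes>\<^bsub>FR\<^esub> frag_of q \<in> tensor_kernel T \<Gamma>" if "q \<in> quads T \<Gamma>" for q
    using a by (induction rule: kernel_induct)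
      (auto simp: FR_mult kernel_diff kernel_0 relator_mult(1) kernel_rel that)
  then show "a \<otimes>\<^bsub>FR\<^esub> x \<in> tensor_kernel T \<Gamma>"
    by (intro frag_induction[OF x, where P = "\<lambda>x. a \<otimes>\<^bsub>FR\<^esub> x \<in> tensor_kernel T \<Gamma>"]) (auto simp: FR_mult kernel_diff kernel_0)
qed

lemma rng_tensor_rng: "rng (tensor_rng T \<Gamma> p)"
  unfolding tensor_rng_def by (rule rng_ideal.rng_quotient[OF kernel_ideal])

lemma pure_tensor_mult:
  assumes "q \<in> quads T \<Gamma>" "r \<in> quads T \<Gamma>"
  shows "pure_tensor T \<Gamma> p q \<otimes>\<^bsub>tensor_rng T \<Gamma> p\<^esub> pure_tensor T \<Gamma> p r
    = pure_tensor T \<Gamma> p (quad_mult p q r)"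
  using rng_ideal.rng_rcoset_mult_add[OF kernel_ideal, of "frag_of q" "frag_of r"] assms
  by (simp add: pure_tensor_def tensor_rng_def FactRing_def FR_mult)

lemma pure_tensor_add:
  assumes "frag_of s - frag_of q - frag_of r \<in> tensor_relators T \<Gamma>"
    "q \<in> quads T \<Gamma>" "r \<in> quads T \<Gamma>" "s \<in> quads T \<Gamma>"
  shows "pure_tensor T \<Gamma> p s = pure_tensor T \<Gamma> p q \<oplus>\<^bsub>tensor_rng T \<Gamma> p\<^esub> pure_tensor T \<Gamma> p r"
proof -
  interpret N: rng_ideal "tensor_kernel T \<Gamma>" FR by (rule kernel_ideal)
  have qr: "frag_of q \<oplus>\<^bsub>FR\<^esub> frag_of r \<in> carrier FR"
    using assms by (intro N.a_closed) auto
  have "frag_of s = (frag_of s - frag_of q - frag_of r) \<oplus>\<^bsub>FR\<^esub> (frag_of q \<oplus>\<^bsub>FR\<^esub> frag_of r)"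
    by simp
  then have "frag_of s \<in> tensor_kernel T \<Gamma> +>\<^bsub>FR\<^esub> (frag_of q \<oplus>\<^bsub>FR\<^esub> frag_of r)"
    using N.a_rcosI[OF kernel_rel[OF assms(1)] N.a_subset qr] by metis
  from N.a_repr_independence'[OF this qr] N.a_rcos_sum[of "frag_of q" "frag_of r"] assms
  show ?thesis by (simp add: pure_tensor_def tensor_rng_def FactRing_def)
qed

lemma pure_tensor_additive:
  assumes "a \<in> carrier T" "\<alpha> \<in> carrier \<Gamma>" "b \<in> carrier T" "\<beta> \<in> carrier \<Gamma>"
  shows "a' \<in> carrier T \<Longrightarrow> pure_tensor T \<Gamma> p (a \<oplus>\<^bsub>T\<^esub> a', \<alpha>, b, \<beta>) =
      pure_tensor T \<Gamma> p (a, \<alpha>, b, \<beta>) \<oplus>\<^bsub>tensor_rng T \<Gamma> p\<^esub> pure_tensor T \<Gamma> p (a', \<alpha>, b, \<beta>)"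
    and "\<alpha>' \<in> carrier \<Gamma> \<Longrightarrow> pure_tensor T \<Gamma> p (a, \<alpha> \<oplus>\<^bsub>\<Gamma>\<^esub> \<alpha>', b, \<beta>) =
      pure_tensor T \<Gamma> p (a, \<alpha>, b, \<beta>) \<oplus>\<^bsub>tensor_rng T \<Gamma> p\<^esub> pure_tensor T \<Gamma> p (a, \<alpha>', b, \<beta>)"
    and "b' \<in> carrier T \<Longrightarrow> pure_tensor T \<Gamma> p (a, \<alpha>, b \<oplus>\<^bsub>T\<^esub> b', \<beta>) =
      pure_tensor T \<Gamma> p (a, \<alpha>, b, \<beta>) \<oplus>\<^bsub>tensor_rng T \<Gamma> p\<^esub> pure_tensor T \<Gamma> p (a, \<alpha>, b', \<beta>)"
    and "\<beta>' \<in> carrier \<Gamma> \<Longrightarrow> pure_tensor T \<Gamma> p (a, \<alpha>, b, \<beta> \<oplus>\<^bsub>\<Gamma>\<^esub> \<beta>') =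
      pure_tensor T \<Gamma> p (a, \<alpha>, b, \<beta>) \<oplus>\<^bsub>tensor_rng T \<Gamma> p\<^esub> pure_tensor T \<Gamma> p (a, \<alpha>, b, \<beta>')"
  by (rule pure_tensor_add; use assms in \<open>simp add: relatorI quads_def\<close>)+

end

end

theory Submission
  imports Defs
begin

text \<open>
  A realization extends additively from quadruples to the free abelian group on them. The extension
  is multiplicative because it is so on generators; additivity in each variable puts the tensor
  relators into its kernel, and the shift identity puts the generators of the operator ideal into
  the kernel of the induced map, so it factors through both quotients. The classes of quadruples
  generate the quotient additively, which gives uniqueness.
\<close>

section \<open>Homomorphisms, ideals and quotients of non-unital rings\<close>

lemma rng_homI:
  assumes "\<And>x. x \<in> carrier R \<Longrightarrow> h x \<in> carrier S"
    and "\<And>x y. \<lbrakk>x \<in> carrier R; y \<in> carrier R\<rbrakk> \<Longrightarrow> h (x \<oplus>\<^bsub>R\<^esub> y) = h x \<oplus>\<^bsub>S\<^esub> h y"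
    and "\<And>x y. \<lbrakk>x \<in> carrier R; y \<in> carrier R\<rbrakk> \<Longrightarrow> h (x \<otimes>\<^bsub>R\<^esub> y) = h x \<otimes>\<^bsub>S\<^esub> h y"
  shows "h \<in> rng_hom R S"
  using assms by (simp add: rng_hom_def)

lemma rng_hom_closed: "h \<in> rng_hom R S \<Longrightarrow> x \<in> carrier R \<Longrightarrow> h x \<in> carrier S"
  by (auto simp: rng_hom_def)

lemma rng_hom_add:
  "h \<in> rng_hom R S \<Longrightarrow> x \<in> carrier R \<Longrightarrow> y \<in> carrier R \<Longrightarrow> h (x \<oplus>\<^bsub>R\<^esub> y) = h x \<oplus>\<^bsub>S\<^esub> h y"
  by (simp add: rng_hom_def)

lemma rng_hom_mult:
  "h \<in> rng_hom R S \<Longrightarrow> x \<in> carrier R \<Longrightarrow> y \<in> carrier R \<Longrightarrow> h (x \<otimes>\<^bsub>R\<^esub> y) = h x \<otimes>\<^bsub>S\<^esub> h y"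
  by (simp add: rng_hom_def)

lemma rng_hom_comp: "h \<in> rng_hom R S \<Longrightarrow> k \<in> rng_hom S U \<Longrightarrow> k \<circ> h \<in> rng_hom R U"
  by (rule rng_homI) (simp_all add: rng_hom_closed rng_hom_add rng_hom_mult)

lemma (in rng) zero_mult: "x \<in> carrier R \<Longrightarrow> \<zero> \<otimes> x = \<zero>" "x \<in> carrier R \<Longrightarrow> x \<otimes> \<zero> = \<zero>"
proof -
  assume x: "x \<in> carrier R"
  \<comment> \<open>Both come from distributing over the sum of zero with itself; cancelling one
    summand then leaves the claim.\<close>
  have "\<zero> \<otimes> x \<oplus> \<zero> \<otimes> x = \<zero> \<otimes> x \<oplus> \<zero>" "x \<otimes> \<zero> \<oplus> x \<otimes> \<zero> = x \<otimes> \<zero> \<oplus> \<zero>"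
    using x rng_l_distr[of \<zero> \<zero> x] rng_r_distr[of \<zero> \<zero> x] by (simp_all add: rng_m_closed)
  then show "\<zero> \<otimes> x = \<zero>" "x \<otimes> \<zero> = \<zero>"
    using x by (simp_all add: rng_m_closed)
qed

lemma (in rng) minus_distr:
  assumes "a \<in> carrier R" "b \<in> carrier R" "c \<in> carrier R"
  shows "(a \<ominus> b) \<otimes> c = a \<otimes> c \<ominus> b \<otimes> c"
    and "c \<otimes> (a \<ominus> b) = c \<otimes> a \<ominus> c \<otimes> b"
proof -
  \<comment> \<open>Multiplying this equation by \<open>c\<close> and distributing over the outer
    sum expresses the product of \<open>a\<close> as a sum; \<open>cancel\<close> then moves one
    summand across, so products of negatives never have to be computed.\<close>
  have ab: "(a \<ominus> b) \<oplus> b = a" using assms by (simp add: a_minus_def a_assoc l_neg)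
  have cancel: "u = v \<ominus> w" if "v = u \<oplus> w" "u \<in> carrier R" "w \<in> carrier R" for u v w
    using that by (simp add: a_minus_def a_assoc r_neg)
  show "(a \<ominus> b) \<otimes> c = a \<otimes> c \<ominus> b \<otimes> c"
    by (rule cancel) (use assms ab rng_l_distr[of "a \<ominus> b" b c] in \<open>auto simp: rng_m_closed\<close>)
  show "c \<otimes> (a \<ominus> b) = c \<otimes> a \<ominus> c \<otimes> b"
    by (rule cancel) (use assms ab rng_r_distr[of "a \<ominus> b" b c] in \<open>auto simp: rng_m_closed\<close>)
qed

text \<open>Makes the additive theory of group homomorphisms, such as preservation of zero and of
  negatives, available for rng homomorphisms.\<close>

lemma rng_hom_abelian_group_hom:
  assumes "rng R" "rng S" "h \<in> rng_hom R S"
  shows "abelian_group_hom R S h"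
proof -
  interpret R: rng R by fact
  interpret S: rng S by fact
  show ?thesis
    by (intro abelian_group_homI R.abelian_group_axioms S.abelian_group_axioms group_hom.intro
        R.a_group S.a_group group_hom_axioms.intro)
      (use assms(3) in \<open>auto simp: hom_def rng_hom_def\<close>)
qed

lemma rng_hom_minus:
  assumes "rng R" "rng S" "h \<in> rng_hom R S" "x \<in> carrier R" "y \<in> carrier R"
  shows "h (x \<ominus>\<^bsub>R\<^esub> y) = h x \<ominus>\<^bsub>S\<^esub> h y"
proof -
  interpret abelian_group_hom R S h by (rule rng_hom_abelian_group_hom) fact+
  show ?thesis using assms by (simp add: a_minus_def)
qed

text \<open>Absorption holds because zero annihilates from both sides. Since kernels are ideals, a
  homomorphism kills a generated ideal as soon as it kills the generators.\<close>

lemma rng_ideal_a_kernel: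
  assumes "rng R" "rng S" "h \<in> rng_hom R S"
  shows "rng_ideal (a_kernel R S h) R"
proof -
  interpret R: rng R by fact
  interpret S: rng S by fact
  interpret abelian_group_hom R S h by (rule rng_hom_abelian_group_hom) fact+
  show ?thesis
  proof (intro rng_ideal.intro rng_ideal_axioms.intro additive_subgroup_a_kernel \<open>rng R\<close>)
    fix a x assume a: "a \<in> a_kernel R S h" and x: "x \<in> carrier R"
    from a have a': "a \<in> carrier R" "h a = \<zero>\<^bsub>S\<^esub>" unfolding a_kernel_def' by blast+
    note hx = rng_hom_closed[OF assms(3) x]
    have "h (x \<otimes>\<^bsub>R\<^esub> a) = \<zero>\<^bsub>S\<^esub>"
      unfolding rng_hom_mult[OF assms(3) x a'(1)] a'(2) by (rule S.zero_mult(2)[OF hx])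
    with R.rng_m_closed[OF x a'(1)] show "x \<otimes>\<^bsub>R\<^esub> a \<in> a_kernel R S h"
      unfolding a_kernel_def' by blast
    have "h (a \<otimes>\<^bsub>R\<^esub> x) = \<zero>\<^bsub>S\<^esub>"
      unfolding rng_hom_mult[OF assms(3) a'(1) x] a'(2) by (rule S.zero_mult(1)[OF hx])
    with R.rng_m_closed[OF a'(1) x] show "a \<otimes>\<^bsub>R\<^esub> x \<in> a_kernel R S h"
      unfolding a_kernel_def' by blast
  qed
qed

lemma (in rng) rng_ideal_genideal:
  assumes "S \<subseteq> carrier R"
  shows "rng_ideal (rng_genideal R S) R"
proof -
  \<comment> \<open>The carrier is an ideal containing \<open>S\<close>, so the family to be
    intersected is nonempty. An empty family would have intersection \<open>UNIV\<close>.\<close>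
  have whole: "rng_ideal (carrier R) R"
    by (intro rng_ideal.intro rng_ideal_axioms.intro additive_subgroup.intro rng_axioms)
      (auto simp: rng_m_closed intro: group.subgroup_self[OF a_group, simplified])
  define \<I> where "\<I> = {I. rng_ideal I R \<and> S \<subseteq> I}"
  have ne: "\<I> \<noteq> {}" using whole assms by (auto simp: \<I>_def)
  have I: "I \<in> \<I> \<Longrightarrow> rng_ideal I R" for I by (simp add: \<I>_def)
  have "subgroup (\<Inter>\<I>) (add_monoid R)"
    by (rule group.subgroups_Inter[OF a_group _ ne])
      (use I in \<open>auto simp: rng_ideal_def additive_subgroup_def\<close>)
  then have "rng_ideal (\<Inter>\<I>) R"
    by (intro rng_ideal.intro rng_ideal_axioms.intro additive_subgroup.intro rng_axioms)
      (auto intro: rng_ideal.rng_I_l_closed[OF I] rng_ideal.rng_I_r_closed[OF I])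
  then show ?thesis by (simp add: rng_genideal_def \<I>_def)
qed

lemma rng_genideal_superset: "S \<subseteq> rng_genideal R S"
  by (auto simp: rng_genideal_def)

lemma rng_genideal_minimal: "rng_ideal I R \<Longrightarrow> S \<subseteq> I \<Longrightarrow> rng_genideal R S \<subseteq> I"
  by (auto simp: rng_genideal_def)

lemma (in rng_ideal) quotient_carrierE:
  assumes "X \<in> carrier (R Quot I)"
  obtains x where "x \<in> carrier R" "X = I +> x"
  using assms by (auto simp: FactRing_simps)

lemma (in rng_ideal) rcos_rng_hom: "(+>) I \<in> rng_hom R (R Quot I)"
  by (rule rng_homI) (auto simp: FactRing_simps rng_rcoset_mult_add a_rcos_sum)

lemma (in rng_ideal) rcos_eqI:
  assumes "x \<in> carrier R" "y \<in> carrier R" "x \<ominus> y \<in> I"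
  shows "I +> x = I +> y"
  using a_repr_independence'[OF _ assms(2)] a_rcos_module[OF assms(2,1)] assms(3)
  by (simp add: a_minus_def)

text \<open>A homomorphism vanishing on \<open>I\<close> is constant on each coset of
  \<open>I\<close> and hence descends. This serves for both quotients, by the tensor kernel and by
  the operator ideal.\<close>

lemma (in rng_ideal) quotient_universal:
  assumes "rng S" "h \<in> rng_hom R S" "I \<subseteq> a_kernel R S h"
  obtains g where "g \<in> rng_hom (R Quot I) S" "\<And>x. x \<in> carrier R \<Longrightarrow> g (I +> x) = h x"
proof -
  interpret S: rng S by fact
  interpret H: abelian_group_hom R S h
    by (rule rng_hom_abelian_group_hom[OF rng_axioms assms(1,2)])
  have wd: "h y = h x" if x: "x \<in> carrier R" and y: "y \<in> I +> x" for x y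
  proof -
    obtain i where i: "i \<in> I" "y = i \<oplus> x" using y unfolding a_r_coset_def' by blast
    have "h i = \<zero>\<^bsub>S\<^esub>" using subsetD[OF assms(3) i(1)] unfolding a_kernel_def' by blast
    then show ?thesis
      unfolding i(2) H.hom_add[OF a_Hcarr[OF i(1)] x] using rng_hom_closed[OF assms(2) x] by simp
  qed
  \<comment> \<open>An arbitrary representative is evaluated; \<open>wd\<close> makes the choice
    immaterial.\<close>
  define g where "g X = h (SOME x. x \<in> X)" for X
  have g: "g (I +> x) = h x" if "x \<in> carrier R" for x
    unfolding g_def using wd[OF that] someI[of "\<lambda>y. y \<in> I +> x", OF a_rcos_self[OF that]] by simp
  have "g \<in> rng_hom (R Quot I) S"
  proof (rule rng_homI)
    fix X assume "X \<in> carrier (R Quot I)"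
    then show "g X \<in> carrier S" by (elim quotient_carrierE) (simp add: g)
  next
    fix X Y assume "X \<in> carrier (R Quot I)" "Y \<in> carrier (R Quot I)"
    then obtain x y where xy: "x \<in> carrier R" "X = I +> x" "y \<in> carrier R" "Y = I +> y"
      by (metis quotient_carrierE)
    show "g (X \<oplus>\<^bsub>R Quot I\<^esub> Y) = g X \<oplus>\<^bsub>S\<^esub> g Y"
      unfolding xy(2,4) rng_hom_add[OF rcos_rng_hom xy(1,3), symmetric]
      by (simp add: g xy(1,3))
    show "g (X \<otimes>\<^bsub>R Quot I\<^esub> Y) = g X \<otimes>\<^bsub>S\<^esub> g Y"
      unfolding xy(2,4) rng_hom_mult[OF rcos_rng_hom xy(1,3), symmetric]
      by (simp add: g xy(1,3) rng_m_closed rng_hom_mult[OF assms(2)])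
  qed
  from this g show thesis by (rule that)
qed

section \<open>Homomorphisms out of the free rng on quadruples\<close>

context ternary_gamma_ring
begin

abbreviation "TR \<equiv> tensor_rng T \<Gamma> p"
abbreviation "OR \<equiv> universal_operator_rng T \<Gamma> p"

text \<open>\<open>frag_induction\<close> builds elements by the difference of finitely supported
  functions, while homomorphisms respect the difference of the ring structure. This identity passes
  from one to the other.\<close>

lemma FR_minus:
  assumes "x \<in> carrier FR" "y \<in> carrier FR"
  shows "x \<ominus>\<^bsub>FR\<^esub> y = x - y"
  using assms unfolding a_minus_def a_inv_def FR_add_monoid by simp

lemma rng_hom_FR_diff:
  assumes "rng B" "h \<in> rng_hom FR B" "Poly_Mapping.keys x \<subseteq> quads T \<Gamma>" "Poly_Mapping.keys y \<subseteq> quads T \<Gamma>"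
  shows "h (x - y) = h x \<ominus>\<^bsub>B\<^esub> h y"
  using rng_hom_minus[OF rng_FR assms(1,2), of x y] assms(3,4) by (simp add: FR_minus)

text \<open>The generators yield every element by repeated differences, and two homomorphisms that
  agree on two elements agree on their difference.\<close>

lemma rng_hom_FR_eqI:
  assumes "rng B" "h \<in> rng_hom FR B" "k \<in> rng_hom FR B"
    and eq: "\<And>q. q \<in> quads T \<Gamma> \<Longrightarrow> h (frag_of q) = k (frag_of q)"
    and "x \<in> carrier FR"
  shows "h x = k x"
proof -
  interpret H: abelian_group_hom FR B h by (rule rng_hom_abelian_group_hom[OF rng_FR assms(1,2)])
  interpret K: abelian_group_hom FR B k by (rule rng_hom_abelian_group_hom[OF rng_FR assms(1,3)])
  have "Poly_Mapping.keys x \<subseteq> quads T \<Gamma>" using assms(5) by simp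
  \<comment> \<open>The support condition is carried through the induction because the difference
    case supplies only the induction predicate, and \<open>rng_hom_FR_diff\<close> needs both
    elements in the carrier.\<close>
  then have "Poly_Mapping.keys x \<subseteq> quads T \<Gamma> \<and> h x = k x"
  proof (induction x rule: frag_induction)
    case zero
    then show ?case using H.hom_zero K.hom_zero by simp
  next
    case (diff a b)
    then show ?case
      using keys_diff[of a b] by (auto simp: rng_hom_FR_diff[OF assms(1)] assms(2,3))
  qed (simp add: eq)
  then show ?thesis ..
qed

text \<open>The universal property of the free abelian group gives the additive map. Its
  multiplicativity on generators spreads to all products, since both sides are biadditive.\<close>

lemma FR_universal:
  assumes "rng B" and l: "l \<in> quads T \<Gamma> \<rightarrow> carrier B"
    and mult: "\<And>q r. q \<in> quads T \<Gamma> \<Longrightarrow> r \<in> quads T \<Gamma> \<Longrightarrow> l (quad_mult p q r) = l q \<otimes>\<^bsub>B\<^esub> l r"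
  obtains h where "h \<in> rng_hom FR B" "\<And>q. q \<in> quads T \<Gamma> \<Longrightarrow> h (frag_of q) = l q"
proof -
  interpret B: rng B by fact
  interpret FR: rng FR by (rule rng_FR)
  obtain h where h: "h \<in> hom (free_Abelian_group (quads T \<Gamma>)) (add_monoid B)"
    and hl: "\<And>q. q \<in> quads T \<Gamma> \<Longrightarrow> h (frag_of q) = l q"
    using comm_group.free_Abelian_group_universal[OF B.a_comm_group, of l "quads T \<Gamma>"] l by auto
  interpret H: abelian_group_hom FR B h
    by (intro abelian_group_homI FR.abelian_group_axioms B.abelian_group_axioms group_hom.intro
        FR.a_group B.a_group group_hom_axioms.intro) (simp only: FR_add_monoid h)
  \<comment> \<open>Only additivity of \<open>h\<close> is known so far, so
    \<open>rng_hom_FR_diff\<close> does not apply yet.\<close>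
  have h_diff: "h (x - y) = h x \<ominus>\<^bsub>B\<^esub> h y" if "Poly_Mapping.keys x \<subseteq> quads T \<Gamma>" "Poly_Mapping.keys y \<subseteq> quads T \<Gamma>" for x y
  proof -
    have xy: "x \<in> carrier FR" "y \<in> carrier FR" using that by simp_all
    have "h (x \<ominus>\<^bsub>FR\<^esub> y) = h x \<ominus>\<^bsub>B\<^esub> h y"
      unfolding a_minus_def H.hom_add[OF xy(1) FR.a_inv_closed[OF xy(2)]] H.hom_a_inv[OF xy(2)] ..
    then show ?thesis using that by (simp add: FR_minus)
  qed
  have zero: "h 0 = \<zero>\<^bsub>B\<^esub>" using H.hom_zero by simp
  have closed: "Poly_Mapping.keys (x \<otimes>\<^bsub>FR\<^esub> y) \<subseteq> quads T \<Gamma>"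
    if "Poly_Mapping.keys x \<subseteq> quads T \<Gamma>" "Poly_Mapping.keys y \<subseteq> quads T \<Gamma>" for x y
    using FR.rng_m_closed[of x y] that by simp
  have hB: "h x \<in> carrier B" if "Poly_Mapping.keys x \<subseteq> quads T \<Gamma>" for x
    using that H.hom_closed by simp
  \<comment> \<open>Multiplicativity by two inductions: here the left factor is a generator and the
    right one varies; in \<open>2\<close> the right factor is fixed and the left one varies.\<close>
  have 1: "Poly_Mapping.keys y \<subseteq> quads T \<Gamma> \<and> h (frag_of q \<otimes>\<^bsub>FR\<^esub> y) = h (frag_of q) \<otimes>\<^bsub>B\<^esub> h y"
    if "Poly_Mapping.keys y \<subseteq> quads T \<Gamma>" and q: "q \<in> quads T \<Gamma>" for q y
    using that(1)
  proof (induction y rule: frag_induction)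
    case (diff a b)
    have "Poly_Mapping.keys (a - b) \<subseteq> quads T \<Gamma>" using diff keys_diff[of a b] by auto
    then show ?case
      using diff q by (simp add: FR_mult h_diff closed B.minus_distr hB)
  qed (use q in \<open>simp_all add: FR_mult zero hl B.zero_mult mult quad_mult_closed funcset_mem[OF l]\<close>)
  have 2: "Poly_Mapping.keys x \<subseteq> quads T \<Gamma> \<and> h (x \<otimes>\<^bsub>FR\<^esub> y) = h x \<otimes>\<^bsub>B\<^esub> h y"
    if "Poly_Mapping.keys x \<subseteq> quads T \<Gamma>" and y: "Poly_Mapping.keys y \<subseteq> quads T \<Gamma>" for x y
    using that(1)
  proof (induction x rule: frag_induction)
    case (diff a b)
    have "Poly_Mapping.keys (a - b) \<subseteq> quads T \<Gamma>" using diff keys_diff[of a b] by auto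
    then show ?case
      using diff y by (simp add: FR_mult h_diff closed B.minus_distr hB)
  qed (use y 1 in \<open>auto simp: FR_mult zero hl hB B.zero_mult\<close>)
  have "h \<in> rng_hom FR B"
    by (rule rng_homI) (use H.hom_closed H.hom_add 2 in \<open>simp_all del: FR_simps(2)\<close>)
  from this hl show thesis by (rule that)
qed

section \<open>The universal operator rng and its canonical realization\<close>

lemma pure_tensor_closed: "q \<in> quads T \<Gamma> \<Longrightarrow> pure_tensor T \<Gamma> p q \<in> carrier TR"
  unfolding pure_tensor_def tensor_rng_def
  by (rule rng_hom_closed[OF rng_ideal.rcos_rng_hom[OF kernel_ideal]]) simp

lemma rng_ideal_operator_ideal: "rng_ideal (operator_ideal T \<Gamma> p) TR"
proof -
  interpret TR: rng TR by (rule rng_tensor_rng)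
  show ?thesis unfolding operator_ideal_def
    by (rule TR.rng_ideal_genideal)
      (auto intro!: TR.minus_closed pure_tensor_closed simp: quads_def p_closed)
qed

lemma rng_universal_operator_rng: "rng OR"
  unfolding universal_operator_rng_def by (rule rng_ideal.rng_quotient[OF rng_ideal_operator_ideal])

lemma coset_hom: "(+>\<^bsub>TR\<^esub>) (operator_ideal T \<Gamma> p) \<in> rng_hom TR OR"
  unfolding universal_operator_rng_def by (rule rng_ideal.rcos_rng_hom[OF rng_ideal_operator_ideal])

lemma operator_class_closed: "q \<in> quads T \<Gamma> \<Longrightarrow> operator_class T \<Gamma> p q \<in> carrier OR"
  unfolding operator_class_def by (rule rng_hom_closed[OF coset_hom pure_tensor_closed])

lemma operator_class_mult:
  assumes "q \<in> quads T \<Gamma>" "r \<in> quads T \<Gamma>"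
  shows "operator_class T \<Gamma> p q \<otimes>\<^bsub>OR\<^esub> operator_class T \<Gamma> p r = operator_class T \<Gamma> p (quad_mult p q r)"
  using rng_hom_mult[OF coset_hom pure_tensor_closed pure_tensor_closed, OF assms] assms
  by (simp add: operator_class_def pure_tensor_mult)

lemma operator_class_add:
  assumes "pure_tensor T \<Gamma> p s = pure_tensor T \<Gamma> p q \<oplus>\<^bsub>TR\<^esub> pure_tensor T \<Gamma> p r"
    and "q \<in> quads T \<Gamma>" "r \<in> quads T \<Gamma>"
  shows "operator_class T \<Gamma> p s = operator_class T \<Gamma> p q \<oplus>\<^bsub>OR\<^esub> operator_class T \<Gamma> p r"
  using rng_hom_add[OF coset_hom pure_tensor_closed pure_tensor_closed, OF assms(2,3)] assms(1)
  by (simp add: operator_class_def)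

text \<open>Additivity and the product rule are inherited from pure tensors through the coset map.
  The shift identity holds because the difference of the two tensors is a generator of the operator
  ideal.\<close>

lemma operator_class_realization: "operator_realization T \<Gamma> p OR (operator_class T \<Gamma> p)"
proof (intro operator_realization.intro operator_realization_axioms.intro
    ternary_gamma_ring_axioms rng_universal_operator_rng)
  show "operator_class T \<Gamma> p \<in> quads T \<Gamma> \<rightarrow> carrier OR"
    using operator_class_closed by blast
  fix a \<alpha> b \<beta> c \<gamma> d \<delta>
  assume *: "a \<in> carrier T" "\<alpha> \<in> carrier \<Gamma>" "b \<in> carrier T" "\<beta> \<in> carrier \<Gamma>"
    "c \<in> carrier T" "\<gamma> \<in> carrier \<Gamma>" "d \<in> carrier T" "\<delta> \<in> carrier \<Gamma>"
  show "operator_class T \<Gamma> p (p a \<alpha> b \<beta> c, \<gamma>, d, \<delta>) = operator_class T \<Gamma> p (a, \<alpha>, p b \<beta> c \<gamma> d, \<delta>)"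
    unfolding operator_class_def
  proof (rule rng_ideal.rcos_eqI[OF rng_ideal_operator_ideal])
    show "pure_tensor T \<Gamma> p (p a \<alpha> b \<beta> c, \<gamma>, d, \<delta>) \<ominus>\<^bsub>TR\<^esub> pure_tensor T \<Gamma> p (a, \<alpha>, p b \<beta> c \<gamma> d, \<delta>)
      \<in> operator_ideal T \<Gamma> p"
      unfolding operator_ideal_def by (rule subsetD[OF rng_genideal_superset]) (use * in blast)
  qed (use * in \<open>simp_all add: pure_tensor_closed quads_def p_closed\<close>)
qed (rule operator_class_add | simp add: operator_class_mult pure_tensor_additive quads_def)+

section \<open>Existence and uniqueness of the induced homomorphism\<close>

text \<open>The maps \<open>h\<close>, \<open>k\<close> and \<open>g\<close> are the successive
  homomorphisms on the free rng, on the tensor rng and on the operator rng, each induced by the one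
  before.\<close>

lemma operator_rng_universal:
  assumes "operator_realization T \<Gamma> p B l"
  obtains h where "h \<in> rng_hom OR B" "\<And>q. q \<in> quads T \<Gamma> \<Longrightarrow> h (operator_class T \<Gamma> p q) = l q"
proof -
  interpret L: operator_realization T \<Gamma> p B l by fact
  have B: "rng B" by (rule L.B.rng_axioms)
  have l: "l q \<in> carrier B" if "q \<in> quads T \<Gamma>" for q using that L.l_closed by auto
  obtain h where h: "h \<in> rng_hom FR B" and hl: "\<And>q. q \<in> quads T \<Gamma> \<Longrightarrow> h (frag_of q) = l q"
    by (rule FR_universal[OF B L.l_closed]) (auto simp: quads_def L.l_mult)
  \<comment> \<open>The left side is the value of \<open>h\<close> on a tensor relator once
    additivity of \<open>l\<close> has been inserted.\<close>
  have cancel: "u \<oplus>\<^bsub>B\<^esub> v \<ominus>\<^bsub>B\<^esub> u \<ominus>\<^bsub>B\<^esub> v = \<zero>\<^bsub>B\<^esub>" if "u \<in> carrier B" "v \<in> carrier B" for u v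
  proof -
    have "u \<oplus>\<^bsub>B\<^esub> v \<ominus>\<^bsub>B\<^esub> u \<ominus>\<^bsub>B\<^esub> v = (u \<oplus>\<^bsub>B\<^esub> v) \<ominus>\<^bsub>B\<^esub> (u \<oplus>\<^bsub>B\<^esub> v)"
      using that by (simp add: a_minus_def L.B.minus_add L.B.a_assoc)
    then show ?thesis using that by (simp add: a_minus_def L.B.r_neg)
  qed
  \<comment> \<open>All four kinds of tensor relator have this shape, and each additivity law of
    \<open>l\<close> provides the last premise, so one argument covers them.\<close>
  have rel: "frag_of s - frag_of q - frag_of r \<in> a_kernel FR B h"
    if "q \<in> quads T \<Gamma>" "r \<in> quads T \<Gamma>" "s \<in> quads T \<Gamma>" "l s = l q \<oplus>\<^bsub>B\<^esub> l r" for q r s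
  proof -
    have "Poly_Mapping.keys (frag_of s - frag_of q) \<subseteq> quads T \<Gamma>" "Poly_Mapping.keys (frag_of s - frag_of q - frag_of r) \<subseteq> quads T \<Gamma>"
      using that by (auto dest!: subsetD[OF keys_diff])
    then show ?thesis
      using that by (simp add: a_kernel_def' rng_hom_FR_diff[OF B h] hl cancel l)
  qed
  \<comment> \<open>The kernel is an additive subgroup, so containing the relators is enough for
    containing all of \<open>tensor_kernel\<close>.\<close>
  interpret ker: rng_ideal "a_kernel FR B h" FR by (rule rng_ideal_a_kernel[OF rng_FR B h])
  have "tensor_relators T \<Gamma> \<subseteq> a_kernel FR B h"
    by (rule subsetI, erule relatorE)
      (rule rel; simp add: quads_def L.l_add1 L.l_add2 L.l_add3 L.l_add4)+
  then have "tensor_kernel T \<Gamma> \<subseteq> a_kernel FR B h"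
    unfolding tensor_kernel_def
    by (rule group.generate_subgroup_incl[OF group_free_Abelian_group])
      (use ker.a_subgroup in \<open>simp only: FR_add_monoid\<close>)
  from rng_ideal.quotient_universal[OF kernel_ideal B h this, folded tensor_rng_def]
  obtain k where k: "k \<in> rng_hom TR B"
    and kh: "\<And>x. x \<in> carrier FR \<Longrightarrow> k (tensor_kernel T \<Gamma> +>\<^bsub>FR\<^esub> x) = h x"
    by blast
  have kl: "k (pure_tensor T \<Gamma> p q) = l q" if "q \<in> quads T \<Gamma>" for q
    using that kh hl by (simp add: pure_tensor_def)
  interpret TR: rng TR by (rule rng_tensor_rng)
  \<comment> \<open>The kernel of \<open>k\<close> is a two-sided ideal, so by minimality only the
    generators matter; on them \<open>l_shift\<close> makes the two values equal.\<close>
  have "operator_ideal T \<Gamma> p \<subseteq> a_kernel TR B k"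
    unfolding operator_ideal_def
  proof (rule rng_genideal_minimal[OF rng_ideal_a_kernel[OF rng_tensor_rng B k]], safe)
    fix a \<alpha> b \<beta> c \<gamma> d \<delta>
    assume *: "a \<in> carrier T" "\<alpha> \<in> carrier \<Gamma>" "b \<in> carrier T" "\<beta> \<in> carrier \<Gamma>"
      "c \<in> carrier T" "\<gamma> \<in> carrier \<Gamma>" "d \<in> carrier T" "\<delta> \<in> carrier \<Gamma>"
    then have q: "(p a \<alpha> b \<beta> c, \<gamma>, d, \<delta>) \<in> quads T \<Gamma>" "(a, \<alpha>, p b \<beta> c \<gamma> d, \<delta>) \<in> quads T \<Gamma>"
      by (simp_all add: quads_def p_closed)
    show "pure_tensor T \<Gamma> p (p a \<alpha> b \<beta> c, \<gamma>, d, \<delta>) \<ominus>\<^bsub>TR\<^esub> pure_tensor T \<Gamma> p (a, \<alpha>, p b \<beta> c \<gamma> d, \<delta>)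
      \<in> a_kernel TR B k"
      using * q l[OF q(2)] rng_hom_minus[OF rng_tensor_rng B k pure_tensor_closed pure_tensor_closed, OF q]
      by (simp add: a_kernel_def' pure_tensor_closed kl L.l_shift a_minus_def L.B.r_neg)
  qed
  from rng_ideal.quotient_universal[OF rng_ideal_operator_ideal B k this, folded universal_operator_rng_def]
  obtain g where "g \<in> rng_hom OR B"
    "\<And>x. x \<in> carrier TR \<Longrightarrow> g (operator_ideal T \<Gamma> p +>\<^bsub>TR\<^esub> x) = k x"
    by blast
  with that show thesis by (simp add: operator_class_def pure_tensor_closed kl)
qed

text \<open>Both maps are pulled back along the composite projection \<open>\<pi>\<close> from the
  free rng, where agreement on generators suffices. As \<open>\<pi>\<close> is surjective, the
  agreement carries over to the quotient.\<close>

lemma rng_hom_operator_rng_eqI: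
  assumes "rng B" "h \<in> rng_hom OR B" "k \<in> rng_hom OR B"
    and eq: "\<And>q. q \<in> quads T \<Gamma> \<Longrightarrow> h (operator_class T \<Gamma> p q) = k (operator_class T \<Gamma> p q)"
    and "X \<in> carrier OR"
  shows "h X = k X"
proof -
  define \<pi> where "\<pi> = (+>\<^bsub>TR\<^esub>) (operator_ideal T \<Gamma> p) \<circ> (+>\<^bsub>FR\<^esub>) (tensor_kernel T \<Gamma>)"
  have \<pi>: "\<pi> \<in> rng_hom FR OR"
    unfolding \<pi>_def
    by (rule rng_hom_comp[OF rng_ideal.rcos_rng_hom[OF kernel_ideal]])
      (simp add: coset_hom flip: tensor_rng_def)
  \<comment> \<open>Surjectivity of \<open>\<pi>\<close>: the element is lifted through one quotient
    at a time.\<close>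
  obtain Y where Y: "Y \<in> carrier TR" "X = operator_ideal T \<Gamma> p +>\<^bsub>TR\<^esub> Y"
    using rng_ideal.quotient_carrierE[OF rng_ideal_operator_ideal] assms(5)
    unfolding universal_operator_rng_def by metis
  obtain x where x: "x \<in> carrier FR" "Y = tensor_kernel T \<Gamma> +>\<^bsub>FR\<^esub> x"
    using rng_ideal.quotient_carrierE[OF kernel_ideal] Y(1)
    unfolding tensor_rng_def by metis
  have "(h \<circ> \<pi>) x = (k \<circ> \<pi>) x"
    by (rule rng_hom_FR_eqI[OF assms(1) rng_hom_comp[OF \<pi> assms(2)] rng_hom_comp[OF \<pi> assms(3)] _ x(1)])
      (use eq in \<open>simp add: \<pi>_def operator_class_def pure_tensor_def\<close>)
  then show ?thesis by (simp add: \<pi>_def Y(2) x(2))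
qed

end

theorem theorem4p4:
  fixes T :: "('t, 'm) ring_scheme" and \<Gamma> :: "('g, 'n) ring_scheme"
    and p :: "'t \<Rightarrow> 'g \<Rightarrow> 't \<Rightarrow> 'g \<Rightarrow> 't \<Rightarrow> 't"
  assumes "ternary_gamma_ring T \<Gamma> p"
  shows "operator_realization T \<Gamma> p (universal_operator_rng T \<Gamma> p) (operator_class T \<Gamma> p)
    \<and> (\<forall>(B :: ('b, 'k) ring_scheme) (l :: 't \<times> 'g \<times> 't \<times> 'g \<Rightarrow> 'b).
        operator_realization T \<Gamma> p B l \<longrightarrow>
        (\<exists>!h. h \<in> rng_hom (universal_operator_rng T \<Gamma> p) B
            \<and> h \<in> extensional (carrier (universal_operator_rng T \<Gamma> p))
            \<and> (\<forall>q \<in> carrier T \<times> carrier \<Gamma> \<times> carrier T \<times> carrier \<Gamma>.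
                 h (operator_class T \<Gamma> p q) = l q)))"
proof -
  interpret ternary_gamma_ring T \<Gamma> p by fact
  interpret O: operator_realization T \<Gamma> p OR "operator_class T \<Gamma> p"
    by (rule operator_class_realization)
  have "\<exists>!h. h \<in> rng_hom OR B \<and> h \<in> extensional (carrier OR)
      \<and> (\<forall>q \<in> quads T \<Gamma>. h (operator_class T \<Gamma> p q) = l q)"
    if L: "operator_realization T \<Gamma> p B l" for B :: "('b, 'k) ring_scheme" and l
  proof -
    have B: "rng B" using L by (rule operator_realization.axioms)
    obtain h where h: "h \<in> rng_hom OR B" "\<And>q. q \<in> quads T \<Gamma> \<Longrightarrow> h (operator_class T \<Gamma> p q) = l q"
      using operator_rng_universal[OF L] by blast
    \<comment> \<open>The homomorphism is determined only on the carrier. Restriction fixes it as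
      \<open>undefined\<close> elsewhere and keeps it a homomorphism, because sums and products stay
      in the carrier.\<close>
    show ?thesis
    proof (rule ex1I[of _ "restrict h (carrier OR)"], intro conjI ballI)
      show "restrict h (carrier OR) \<in> rng_hom OR B"
        by (rule rng_homI)
          (use h(1) O.B.rng_m_closed in \<open>auto simp: rng_hom_closed rng_hom_add rng_hom_mult\<close>)
      show "restrict h (carrier OR) (operator_class T \<Gamma> p q) = l q" if "q \<in> quads T \<Gamma>" for q
        using that O.l_closed h(2) by auto
    next
      fix k assume k: "k \<in> rng_hom OR B \<and> k \<in> extensional (carrier OR)
        \<and> (\<forall>q \<in> quads T \<Gamma>. k (operator_class T \<Gamma> p q) = l q)"
      \<comment> \<open>Agreement on the classes gives agreement on the carrier, and outside it both
        functions are \<open>undefined\<close>.\<close>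
      show "k = restrict h (carrier OR)"
        by (rule extensionalityI[of _ "carrier OR"])
          (use k h rng_hom_operator_rng_eqI[OF B, of k h] in auto)
    qed simp
  qed
  then show ?thesis using operator_class_realization by (simp add: quads_def)
qed

end
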